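(* There is an absolute constant $K>0$ such that for all real $Q \ge 2$ and $x \ge 2$, $$ \sum_{q \leq Q}\ \sum_{c, d \in \mathbb{F}_q^{*} } \left|\ \mathop{{\sum}'}_{p \leq x} e\left(\frac{pd - i_p c}{q}\right) \right|^2 \ \leq\ K\, (Q + x^{1/2} \log x)\, (Q^2 + x)\, \pi(x). $$
   Context: Notation: $e(t) = e^{2\pi i t}$; $\pi(x)$ is the number of primes $\le x$. The sum $\sum_{q\le Q}$ runs over odd primes $q \le Q$; $\mathbb{F}_q^{*}$ is identified with the residues $\{1,\dots,q-1\}$ modulo $q$. For an odd prime $p$, $i_p = [\mathbb{F}_p^* : \langle 2\rangle]$ denotes the index of the subgroup generated by $2$ modulo $p$. The primed sum $\mathop{{\sum}'}_{p\le x}$ runs over odd primes $p \le x$ satisfying $i_p \le \sqrt{x}\,\log x$. *)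

theory Defs
  imports
    "HOL-Analysis.Analysis"
    "HOL-Algebra.Generated_Groups"
    "HOL-Number_Theory.Residues"
begin

definition e :: "real \<Rightarrow> complex" where
  "e t = exp (2 * of_real pi * \<i> * of_real t)"

definition primes_pi :: "real \<Rightarrow> nat" where
  "primes_pi x = card {p :: nat. prime p \<and> real p \<le> x}"

definition odd_primes_upto :: "real \<Rightarrow> nat set" where
  "odd_primes_upto x = {p. prime p \<and> odd p \<and> real p \<le> x}"

(* The carrier of residue_ring (int p) is {0..int p - 1}, so the literal 2 represents the
   residue class of 2 exactly when p > 2; the definition is only meant for odd primes. *)
definition index2 :: "nat \<Rightarrow> nat" where
  "index2 p =
     (let G = units_of (residue_ring (int p))
      in card (rcosets\<^bsub>G\<^esub> (generate G {2})))"

definition admissible_primes :: "real \<Rightarrow> nat set" where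
  "admissible_primes x = {p \<in> odd_primes_upto x. real (index2 p) \<le> sqrt x * ln x}"

end

theory Submission
  imports Defs
begin

text \<open>For fixed \<open>q\<close> and \<open>d\<close> the inner sum is grouped by the value \<open>m\<close> of \<open>i\<^sub>p\<close>. Extending the
  sum over \<open>c\<close> to all residues modulo \<open>q\<close>, orthogonality pairs only values congruent modulo
  \<open>q\<close>, and each residue class contains at most \<open>M / q + 1\<close> of the \<open>m \<le> M = \<surd>x log x\<close>; this costs
  the factor \<open>q + M\<close>. For each \<open>m\<close> the remaining sum over \<open>q\<close> and \<open>d\<close> is bounded by
  \<open>O(Q\<^sup>2 + x)\<close> times the number of \<open>p\<close> with \<open>i\<^sub>p = m\<close>, by the large sieve for the fractions
  \<open>d / q\<close>, which are spaced by \<open>1 / Q\<^sup>2\<close>. The large sieve is proved by duality; treating the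
  fractions in the two halves of the unit interval separately avoids distances modulo 1.\<close>

section \<open>The additive character\<close>

lemma e_add: "e (s + t) = e s * e t"
  by (simp add: e_def ring_distribs exp_add)

lemma e_0 [simp]: "e 0 = 1"
  by (simp add: e_def)

lemma cnj_e: "cnj (e t) = e (- t)"
  by (simp add: e_def exp_cnj)

lemma norm_e [simp]: "cmod (e t) = 1"
  by (simp add: e_def)

lemma e_power: "e t ^ n = e (real n * t)"
  by (simp add: e_def exp_of_nat_mult [symmetric] mult_ac)

lemma e_eq_1_iff: "e t = 1 \<longleftrightarrow> t \<in> \<int>"
proof -
  have "e t = 1 \<longleftrightarrow> (\<exists>n::int. 2 * pi * t = of_int (2 * n) * pi)"
    unfolding e_def exp_eq_1 by simp
  also have "\<dots> \<longleftrightarrow> (\<exists>n::int. t = of_int n)"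
    by (simp add: field_simps)
  finally show ?thesis by (auto elim: Ints_cases)
qed

section \<open>Bounds for inverse squares and geometric sums\<close>

lemma sum_inverse_squares_le:
  fixes A :: "nat set"
  assumes "finite A" "0 \<notin> A"
  shows "(\<Sum>k\<in>A. 1 / (real k)\<^sup>2) \<le> 2"
proof -
  \<comment> \<open>Subtracting \<open>1 / Suc n\<close> makes the induction close: the next term is
    at most \<open>1 / (k * (k + 1))\<close>, which telescopes.\<close>
  have ind: "(\<Sum>k=1..Suc n. 1 / (real k)\<^sup>2) \<le> 2 - 1 / real (Suc n)" for n
  proof (induction n)
    case (Suc n)
    have "1 / (real (Suc (Suc n)))\<^sup>2 \<le> 1 / (real (Suc n) * real (Suc (Suc n)))"
      unfolding power2_eq_square by (intro divide_left_mono mult_right_mono) auto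
    also have "\<dots> = 1 / real (Suc n) - 1 / real (Suc (Suc n))"
      by (simp add: field_simps)
    finally show ?case using Suc.IH by simp
  qed simp
  obtain n where "A \<subseteq> {..n}" using assms(1) finite_nat_iff_bounded_le by blast
  then have "A \<subseteq> {1..Suc n}" using assms(2) by (fastforce simp: Suc_le_eq intro: gr0I)
  then have "(\<Sum>k\<in>A. 1 / (real k)\<^sup>2) \<le> (\<Sum>k=1..Suc n. 1 / (real k)\<^sup>2)"
    by (intro sum_mono2) auto
  also have "\<dots> \<le> 2 - 1 / real (Suc n)" by (rule ind)
  also have "\<dots> \<le> 2" by simp
  finally show ?thesis .
qed

text \<open>Jordan's inequality: by concavity the sine lies above its chord over the interval from 0
  to pi / 2.\<close>

lemma sin_pi_mult_ge:
  assumes "0 \<le> t" "t \<le> 1 / 2"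
  shows "sin (pi * t) \<ge> 2 * t"
proof -
  have "concave_on {0..pi / 2} sin"
    by (rule f''_le0_imp_concave [where f' = cos and f'' = "\<lambda>x. - sin x"])
       (auto intro!: derivative_eq_intros sin_ge_zero)
  then have "(1 - 2 * t) * sin 0 + 2 * t * sin (pi / 2) \<le> sin ((1 - 2 * t) *\<^sub>R 0 + (2 * t) *\<^sub>R (pi / 2))"
    using assms by (intro concave_onD) auto
  then show ?thesis by (simp add: mult_ac)
qed

text \<open>The chord from 1 to \<open>e t\<close> has length 2 |sin (pi t)|, so Jordan's inequality
  applies.\<close>

lemma norm_e_minus_1_ge:
  assumes "\<bar>t\<bar> \<le> 1 / 2"
  shows "cmod (e t - 1) \<ge> 4 * \<bar>t\<bar>"
proof -
  have "e t = exp (\<i> * of_real (2 * pi * t))"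
    by (simp add: e_def mult_ac)
  then have "cmod (e t - 1) = 2 * \<bar>sin (pi * t)\<bar>"
    by (simp only: dist_exp_i_1) simp
  also have "\<bar>sin (pi * t)\<bar> = \<bar>sin (pi * \<bar>t\<bar>)\<bar>"
    by (cases "t \<ge> 0") auto
  finally show ?thesis using sin_pi_mult_ge [of "\<bar>t\<bar>"] assms by simp
qed

text \<open>Multiplying the geometric sum by \<open>e t - 1\<close> leaves a difference of two
  numbers of modulus 1, hence a bound independent of \<open>L\<close>.\<close>

lemma norm_sum_e_le:
  assumes "t \<noteq> 0" "\<bar>t\<bar> \<le> 1 / 2"
  shows "cmod (\<Sum>j<L. e (real j * t)) \<le> 1 / (2 * \<bar>t\<bar>)"
proof -
  have "(e t - 1) * (\<Sum>j<L. e (real j * t)) = e (real L * t) - 1"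
    using power_diff_1_eq [of "e t" L] by (simp add: e_power)
  then have "cmod (e t - 1) * cmod (\<Sum>j<L. e (real j * t)) = cmod (e (real L * t) - 1)"
    by (metis norm_mult)
  also have "\<dots> \<le> 2"
    using norm_triangle_ineq4 [of "e (real L * t)" 1] by simp
  finally have "4 * \<bar>t\<bar> * cmod (\<Sum>j<L. e (real j * t)) \<le> 2"
    using norm_e_minus_1_ge [OF assms(2)] mult_right_mono [OF _ norm_ge_zero] order_trans by blast
  then show ?thesis using assms by (simp add: field_simps)
qed

section \<open>The large sieve for well-spaced points\<close>

text \<open>Schur's test for the Gram matrix of the vectors \<open>E \<cdot> r\<close>.\<close>

lemma sum_norm_square_le_row_sum:
  fixes E :: "'t \<Rightarrow> 'r \<Rightarrow> complex"
  assumes gram: "\<And>r s. r \<in> A \<Longrightarrow> s \<in> A \<Longrightarrow> cmod (\<Sum>t\<in>T. E t r * cnj (E t s)) \<le> \<kappa> r s"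
    and sym: "\<And>r s. \<kappa> r s = \<kappa> s r"
    and row: "\<And>r. r \<in> A \<Longrightarrow> (\<Sum>s\<in>A. \<kappa> r s) \<le> B"
  shows "(\<Sum>t\<in>T. (cmod (\<Sum>r\<in>A. c r * E t r))\<^sup>2) \<le> B * (\<Sum>r\<in>A. (cmod (c r))\<^sup>2)"
proof -
  have "complex_of_real (\<Sum>t\<in>T. (cmod (\<Sum>r\<in>A. c r * E t r))\<^sup>2)
      = (\<Sum>t\<in>T. \<Sum>r\<in>A. \<Sum>s\<in>A. (c r * E t r) * cnj (c s * E t s))"
    by (simp only: of_real_sum complex_norm_square cnj_sum sum_product)
  also have "\<dots> = (\<Sum>r\<in>A. \<Sum>s\<in>A. \<Sum>t\<in>T. (c r * E t r) * cnj (c s * E t s))"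
    by (subst sum.swap, rule sum.cong [OF refl], rule sum.swap)
  also have "\<dots> = (\<Sum>r\<in>A. \<Sum>s\<in>A. c r * cnj (c s) * (\<Sum>t\<in>T. E t r * cnj (E t s)))"
    by (simp add: sum_distrib_left mult_ac)
  finally have "(\<Sum>t\<in>T. (cmod (\<Sum>r\<in>A. c r * E t r))\<^sup>2)
      = Re (\<Sum>r\<in>A. \<Sum>s\<in>A. c r * cnj (c s) * (\<Sum>t\<in>T. E t r * cnj (E t s)))"
    by (metis Re_complex_of_real)
  also have "\<dots> \<le> (\<Sum>r\<in>A. \<Sum>s\<in>A. cmod (c r) * cmod (c s) * cmod (\<Sum>t\<in>T. E t r * cnj (E t s)))"
    by (intro order_trans [OF complex_Re_le_cmod] sum_norm_le) (simp add: norm_mult)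
  \<comment> \<open>The arithmetic-geometric mean inequality splits the double sum into two halves.
    The symmetry of \<kappa> makes them equal, so row sums alone control the total.\<close>
  also have "\<dots> \<le> (\<Sum>r\<in>A. \<Sum>s\<in>A. ((cmod (c r))\<^sup>2 + (cmod (c s))\<^sup>2) / 2 * \<kappa> r s)"
  proof (intro sum_mono mult_mono gram)
    fix r s
    show "cmod (c r) * cmod (c s) \<le> ((cmod (c r))\<^sup>2 + (cmod (c s))\<^sup>2) / 2"
      using sum_squares_bound [of "cmod (c r)" "cmod (c s)"] by simp
  qed auto
  also have "\<dots> = (\<Sum>r\<in>A. \<Sum>s\<in>A. (cmod (c r))\<^sup>2 / 2 * \<kappa> r s)
      + (\<Sum>r\<in>A. \<Sum>s\<in>A. (cmod (c s))\<^sup>2 / 2 * \<kappa> r s)"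
    by (simp add: sum.distrib add_divide_distrib ring_distribs)
  also have "(\<Sum>r\<in>A. \<Sum>s\<in>A. (cmod (c s))\<^sup>2 / 2 * \<kappa> r s)
      = (\<Sum>r\<in>A. \<Sum>s\<in>A. (cmod (c r))\<^sup>2 / 2 * \<kappa> r s)"
    by (subst sum.swap) (simp only: sym)
  also have "(\<Sum>r\<in>A. \<Sum>s\<in>A. (cmod (c r))\<^sup>2 / 2 * \<kappa> r s) + \<dots>
      = (\<Sum>r\<in>A. (cmod (c r))\<^sup>2 * (\<Sum>s\<in>A. \<kappa> r s))"
    by (simp add: sum_distrib_left mult.commute [of "_\<^sup>2"] flip: sum.distrib)
  also have "\<dots> \<le> (\<Sum>r\<in>A. (cmod (c r))\<^sup>2 * B)"
    by (intro sum_mono mult_left_mono row) auto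
  also have "\<dots> = B * (\<Sum>r\<in>A. (cmod (c r))\<^sup>2)"
    by (simp add: sum_distrib_left mult.commute)
  finally show ?thesis .
qed

text \<open>Rounding \<theta> / \<delta> down gives positive integers \<open>k r\<close> with
  \<open>k r * \<delta>\<close> \<le> \<theta>. They are distinct, since two points in one half-open
  interval of length \<delta> would violate the spacing; so the sum is compared with that of 1 /
  k^2.\<close>

lemma sum_inverse_squares_separated_le:
  fixes \<theta> :: "'r \<Rightarrow> real"
  assumes "finite A" "\<delta> > 0"
    and sep: "\<And>r s. r \<in> A \<Longrightarrow> s \<in> A \<Longrightarrow> r \<noteq> s \<Longrightarrow> \<bar>\<theta> r - \<theta> s\<bar> \<ge> \<delta>"
    and ge: "\<And>r. r \<in> A \<Longrightarrow> \<theta> r \<ge> \<delta>"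
  shows "(\<Sum>r\<in>A. 1 / (\<theta> r)\<^sup>2) \<le> 2 / \<delta>\<^sup>2"
proof -
  define k where "k r = nat \<lfloor>\<theta> r / \<delta>\<rfloor>" for r
  have k: "real (k r) = of_int \<lfloor>\<theta> r / \<delta>\<rfloor>" "real (k r) \<ge> 1" if "r \<in> A" for r
  proof -
    have "\<theta> r / \<delta> \<ge> 1" using ge [OF that] \<open>\<delta> > 0\<close> by simp
    then have "\<lfloor>\<theta> r / \<delta>\<rfloor> \<ge> 1" by simp
    then show "real (k r) = of_int \<lfloor>\<theta> r / \<delta>\<rfloor>" "real (k r) \<ge> 1"
      by (auto simp: k_def)
  qed
  have le: "real (k r) * \<delta> \<le> \<theta> r" "\<theta> r < (real (k r) + 1) * \<delta>" if "r \<in> A" for r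
    using floor_correct [of "\<theta> r / \<delta>"] k(1) [OF that] \<open>\<delta> > 0\<close>
    by (simp_all only: pos_le_divide_eq pos_divide_less_eq of_int_add of_int_1)
  have inj: "inj_on k A"
  proof (rule inj_onI, rule ccontr)
    fix r s assume "r \<in> A" "s \<in> A" "k r = k s" "r \<noteq> s"
    then show False
      using le [of r] le [of s] sep [of r s] by (auto simp: abs_if ring_distribs split: if_splits)
  qed
  have "(\<Sum>r\<in>A. 1 / (\<theta> r)\<^sup>2) \<le> (\<Sum>r\<in>A. 1 / (real (k r) * \<delta>)\<^sup>2)"
  proof (intro sum_mono divide_left_mono power_mono le)
    fix r assume "r \<in> A"
    then show "0 < (\<theta> r)\<^sup>2 * (real (k r) * \<delta>)\<^sup>2"
      using k(2) [of r] ge [of r] \<open>\<delta> > 0\<close> by (intro mult_pos_pos zero_less_power) auto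
  qed (use \<open>\<delta> > 0\<close> in auto)
  also have "\<dots> = (\<Sum>r\<in>A. 1 / (real (k r))\<^sup>2) / \<delta>\<^sup>2"
    by (simp add: sum_divide_distrib power_mult_distrib)
  also have "(\<Sum>r\<in>A. 1 / (real (k r))\<^sup>2) = (\<Sum>j\<in>k ` A. 1 / (real j)\<^sup>2)"
    by (simp add: sum.reindex [OF inj])
  also have "\<dots> \<le> 2"
    using \<open>finite A\<close> k(2) by (intro sum_inverse_squares_le) fastforce+
  finally show ?thesis using \<open>\<delta> > 0\<close> by (simp add: divide_right_mono)
qed

text \<open>To the left and to the right of \<open>\<alpha> r\<close>, the distances to
  \<open>\<alpha> r\<close> are at least \<delta> and again spaced by \<delta>; each side
  contributes \<open>2 / \<delta>\<^sup>2\<close>.\<close>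

lemma sum_inverse_squares_diff_le:
  fixes \<alpha> :: "'r \<Rightarrow> real"
  assumes "finite A" "\<delta> > 0" "r \<in> A"
    and sep: "\<And>r s. r \<in> A \<Longrightarrow> s \<in> A \<Longrightarrow> r \<noteq> s \<Longrightarrow> \<bar>\<alpha> r - \<alpha> s\<bar> \<ge> \<delta>"
  shows "(\<Sum>s\<in>A - {r}. 1 / (\<alpha> r - \<alpha> s)\<^sup>2) \<le> 4 / \<delta>\<^sup>2"
proof -
  let ?U = "{s \<in> A - {r}. \<alpha> s < \<alpha> r}" and ?V = "{s \<in> A - {r}. \<not> \<alpha> s < \<alpha> r}"
  have "(\<Sum>s\<in>A - {r}. 1 / (\<alpha> r - \<alpha> s)\<^sup>2)
      = (\<Sum>s\<in>?U. 1 / (\<alpha> r - \<alpha> s)\<^sup>2) + (\<Sum>s\<in>?V. 1 / (\<alpha> r - \<alpha> s)\<^sup>2)"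
    using \<open>finite A\<close> by (subst sum.union_disjoint [symmetric]) (auto intro!: sum.cong)
  also have "(\<Sum>s\<in>?U. 1 / (\<alpha> r - \<alpha> s)\<^sup>2) \<le> 2 / \<delta>\<^sup>2"
  proof (rule sum_inverse_squares_separated_le)
    show "\<alpha> r - \<alpha> s \<ge> \<delta>" if "s \<in> ?U" for s using sep [of r s] that assms(3) by auto
    show "\<bar>(\<alpha> r - \<alpha> s) - (\<alpha> r - \<alpha> t)\<bar> \<ge> \<delta>" if "s \<in> ?U" "t \<in> ?U" "s \<noteq> t" for s t
      using sep [of s t] that by auto
  qed (use assms in auto)
  also have "(\<Sum>s\<in>?V. 1 / (\<alpha> r - \<alpha> s)\<^sup>2) = (\<Sum>s\<in>?V. 1 / (\<alpha> s - \<alpha> r)\<^sup>2)"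
    by (simp add: power2_commute)
  also have "\<dots> \<le> 2 / \<delta>\<^sup>2"
  proof (rule sum_inverse_squares_separated_le)
    show "\<alpha> s - \<alpha> r \<ge> \<delta>" if "s \<in> ?V" for s using sep [of r s] that assms(3) by auto
    show "\<bar>(\<alpha> s - \<alpha> r) - (\<alpha> t - \<alpha> r)\<bar> \<ge> \<delta>" if "s \<in> ?V" "t \<in> ?V" "s \<noteq> t" for s t
      using sep [of s t] that by auto
  qed (use assms in auto)
  finally show ?thesis by simp
qed

text \<open>Summing over the differences \<open>j - k\<close> with \<open>j < 2 * L\<close> and \<open>k < L\<close> counts every
  \<open>n \<le> L\<close> at least \<open>L\<close> times, while the kernel factors into two geometric sums; this
  replaces the Fejer weight.\<close>

lemma dual_large_sieve:
  fixes \<alpha> :: "'r \<Rightarrow> real"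
  assumes "finite A" "\<delta> > 0"
    and sep: "\<And>r s. r \<in> A \<Longrightarrow> s \<in> A \<Longrightarrow> r \<noteq> s \<Longrightarrow> \<bar>\<alpha> r - \<alpha> s\<bar> \<ge> \<delta>"
    and near: "\<And>r s. r \<in> A \<Longrightarrow> s \<in> A \<Longrightarrow> \<bar>\<alpha> r - \<alpha> s\<bar> \<le> 1 / 2"
    and L: "real L \<ge> 1 / \<delta>"
  shows "(\<Sum>n\<le>L. (cmod (\<Sum>r\<in>A. c r * e (real n * \<alpha> r)))\<^sup>2) \<le> 3 * real L * (\<Sum>r\<in>A. (cmod (c r))\<^sup>2)"
proof -
  define f where "f u = (cmod (\<Sum>r\<in>A. c r * e (u * \<alpha> r)))\<^sup>2" for u :: real
  \<comment> \<open>On the diagonal all \<open>L * (2 * L)\<close> terms equal 1. Off it, each of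
    the two geometric sums is at most 1 / (2 |\<alpha> r - \<alpha> s|).\<close>
  define \<kappa> where "\<kappa> r s = (if r = s then 2 * (real L)\<^sup>2 else 1 / (4 * (\<alpha> r - \<alpha> s)\<^sup>2))" for r s
  define T where "T = {..<L} \<times> {..<2 * L}"
  have "L > 0" using L \<open>\<delta> > 0\<close> by (auto intro!: gr0I simp: field_simps)
  have "real L * (\<Sum>n\<le>L. f (real n)) = (\<Sum>k<L. \<Sum>n\<le>L. f (real n))"
    by simp
  also have "\<dots> \<le> (\<Sum>k<L. \<Sum>j<2 * L. f (real j - real k))"
  proof (rule sum_mono)
    fix k assume "k \<in> {..<L}"
    \<comment> \<open>The substitution j = n + k stays below \<open>2 * L\<close>, because n \<le> L
      and k < L.\<close>
    have "(\<Sum>n\<le>L. f (real n)) = (\<Sum>j\<in>(\<lambda>n. n + k) ` {..L}. f (real j - real k))"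
      by (subst sum.reindex) auto
    also have "\<dots> \<le> (\<Sum>j<2 * L. f (real j - real k))"
      using \<open>k \<in> {..<L}\<close> by (intro sum_mono2) (auto simp: f_def)
    finally show "(\<Sum>n\<le>L. f (real n)) \<le> (\<Sum>j<2 * L. f (real j - real k))" .
  qed
  also have "\<dots> = (\<Sum>t\<in>T. (cmod (\<Sum>r\<in>A. c r * e ((real (snd t) - real (fst t)) * \<alpha> r)))\<^sup>2)"
    by (simp add: T_def f_def sum.cartesian_product case_prod_unfold)
  also have "\<dots> \<le> 3 * (real L)\<^sup>2 * (\<Sum>r\<in>A. (cmod (c r))\<^sup>2)"
  proof (rule sum_norm_square_le_row_sum [where \<kappa> = \<kappa>])
    show "\<kappa> r s = \<kappa> s r" for r s by (simp add: \<kappa>_def power2_commute)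
  next
    fix r s assume rs: "r \<in> A" "s \<in> A"
    let ?K = "\<Sum>t\<in>T. e ((real (snd t) - real (fst t)) * \<alpha> r) * cnj (e ((real (snd t) - real (fst t)) * \<alpha> s))"
    have "?K = (\<Sum>t\<in>T. cnj (e (real (fst t) * (\<alpha> r - \<alpha> s))) * e (real (snd t) * (\<alpha> r - \<alpha> s)))"
      by (intro sum.cong refl) (simp add: cnj_e algebra_simps flip: e_add)
    also have "\<dots> = cnj (\<Sum>k<L. e (real k * (\<alpha> r - \<alpha> s))) * (\<Sum>j<2 * L. e (real j * (\<alpha> r - \<alpha> s)))"
      by (simp add: T_def sum_product sum.cartesian_product case_prod_unfold)
    finally have "cmod ?K = cmod (\<Sum>k<L. e (real k * (\<alpha> r - \<alpha> s)))
        * cmod (\<Sum>j<2 * L. e (real j * (\<alpha> r - \<alpha> s)))"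
      by (simp add: norm_mult del: cnj_sum)
    also have "\<dots> \<le> \<kappa> r s"
    proof (cases "r = s")
      case True
      then show ?thesis by (simp add: \<kappa>_def power2_eq_square norm_mult)
    next
      case False
      then have "\<alpha> r - \<alpha> s \<noteq> 0" using sep [OF rs False] \<open>\<delta> > 0\<close> by auto
      then have "cmod (\<Sum>k<L. e (real k * (\<alpha> r - \<alpha> s))) * cmod (\<Sum>j<2 * L. e (real j * (\<alpha> r - \<alpha> s)))
          \<le> 1 / (2 * \<bar>\<alpha> r - \<alpha> s\<bar>) * (1 / (2 * \<bar>\<alpha> r - \<alpha> s\<bar>))"
        using near [OF rs] by (intro mult_mono norm_sum_e_le) auto
      also have "\<dots> = \<kappa> r s"
        using False by (simp add: \<kappa>_def power2_eq_square)
      finally show ?thesis .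
    qed
    finally show "cmod ?K \<le> \<kappa> r s" .
  next
    fix r assume "r \<in> A"
    have "(\<Sum>s\<in>A. \<kappa> r s) = 2 * (real L)\<^sup>2 + (\<Sum>s\<in>A - {r}. \<kappa> r s)"
      using \<open>finite A\<close> \<open>r \<in> A\<close> by (subst sum.remove [of A r]) (auto simp: \<kappa>_def)
    also have "(\<Sum>s\<in>A - {r}. \<kappa> r s) = (\<Sum>s\<in>A - {r}. 1 / (\<alpha> r - \<alpha> s)\<^sup>2) / 4"
      unfolding sum_divide_distrib by (intro sum.cong) (auto simp: \<kappa>_def)
    \<comment> \<open>The off-diagonal part \<open>4 / \<delta>\<^sup>2\<close>, divided by 4, is at
      most \<open>L\<^sup>2\<close> by the choice of \<open>L\<close>; with the diagonal
      \<open>2 * L\<^sup>2\<close> this gives the constant 3.\<close>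
    also have "\<dots> \<le> (1 / \<delta>)\<^sup>2"
      using sum_inverse_squares_diff_le [OF assms(1,2) \<open>r \<in> A\<close> sep] by (simp add: power_divide)
    also have "\<dots> \<le> (real L)\<^sup>2"
      using L \<open>\<delta> > 0\<close> by (intro power_mono) auto
    finally show "(\<Sum>s\<in>A. \<kappa> r s) \<le> 3 * (real L)\<^sup>2" by simp
  qed
  also have "\<dots> = real L * (3 * real L * (\<Sum>r\<in>A. (cmod (c r))\<^sup>2))"
    by (simp add: power2_eq_square)
  finally show ?thesis
    using \<open>L > 0\<close> by (simp add: f_def)
qed

text \<open>Duality: with the coefficients \<open>cnj (S r)\<close> in the dual sum
  \<open>F\<close>, the left-hand side \<open>X\<close> equals the sum of \<open>a n * F n\<close>.
  Cauchy-Schwarz and \<open>dual_large_sieve\<close> bound \<open>X\<^sup>2\<close> by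
  \<open>3 * L * Y * X\<close>, and one factor \<open>X\<close> cancels.\<close>

lemma large_sieve_half_interval:
  fixes \<alpha> :: "'r \<Rightarrow> real"
  assumes "finite A" "\<delta> > 0"
    and sep: "\<And>r s. r \<in> A \<Longrightarrow> s \<in> A \<Longrightarrow> r \<noteq> s \<Longrightarrow> \<bar>\<alpha> r - \<alpha> s\<bar> \<ge> \<delta>"
    and near: "\<And>r s. r \<in> A \<Longrightarrow> s \<in> A \<Longrightarrow> \<bar>\<alpha> r - \<alpha> s\<bar> \<le> 1 / 2"
    and L: "real L \<ge> 1 / \<delta>" and N: "N \<subseteq> {..L}"
  shows "(\<Sum>r\<in>A. (cmod (\<Sum>n\<in>N. a n * e (real n * \<alpha> r)))\<^sup>2) \<le> 3 * real L * (\<Sum>n\<in>N. (cmod (a n))\<^sup>2)"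
proof -
  define S where "S r = (\<Sum>n\<in>N. a n * e (real n * \<alpha> r))" for r
  define F where "F n = (\<Sum>r\<in>A. cnj (S r) * e (real n * \<alpha> r))" for n :: nat
  define X where "X = (\<Sum>r\<in>A. (cmod (S r))\<^sup>2)"
  define Y where "Y = (\<Sum>n\<in>N. (cmod (a n))\<^sup>2)"
  have XY: "X \<ge> 0" "Y \<ge> 0" by (auto simp: X_def Y_def sum_nonneg)
  have "complex_of_real X = (\<Sum>r\<in>A. S r * cnj (S r))"
    by (simp only: X_def of_real_sum complex_norm_square)
  also have "\<dots> = (\<Sum>r\<in>A. \<Sum>n\<in>N. a n * e (real n * \<alpha> r) * cnj (S r))"
    by (subst (1) S_def) (simp add: sum_distrib_right)
  also have "\<dots> = (\<Sum>n\<in>N. a n * F n)"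
    by (subst sum.swap) (simp add: F_def sum_distrib_left mult_ac)
  finally have "X = cmod (\<Sum>n\<in>N. a n * F n)"
    using XY by (metis abs_of_nonneg norm_of_real)
  also have "\<dots> \<le> (\<Sum>n\<in>N. cmod (a n) * cmod (F n))"
    by (intro sum_norm_le) (simp add: norm_mult)
  finally have "X\<^sup>2 \<le> (\<Sum>n\<in>N. cmod (a n) * cmod (F n))\<^sup>2"
    using XY by (intro power_mono)
  also have "\<dots> \<le> Y * (\<Sum>n\<in>N. (cmod (F n))\<^sup>2)"
    unfolding Y_def by (rule Cauchy_Schwarz_ineq_sum)
  also have "\<dots> \<le> Y * (3 * real L * X)"
  proof (rule mult_left_mono)
    have "(\<Sum>n\<in>N. (cmod (F n))\<^sup>2) \<le> (\<Sum>n\<le>L. (cmod (F n))\<^sup>2)"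
      using N by (intro sum_mono2) auto
    also have "\<dots> \<le> 3 * real L * X"
      using dual_large_sieve [OF assms(1-5), where c = "\<lambda>r. cnj (S r)"] by (simp add: F_def X_def)
    finally show "(\<Sum>n\<in>N. (cmod (F n))\<^sup>2) \<le> 3 * real L * X" .
  qed fact
  finally have "X * X \<le> (3 * real L * Y) * X"
    by (simp add: power2_eq_square mult_ac)
  then have "X \<le> 3 * real L * Y"
    using XY by (cases "X = 0") auto
  then show ?thesis by (simp add: X_def Y_def S_def)
qed

section \<open>The large sieve at fractions with prime denominator\<close>

lemma finite_odd_primes_upto: "finite (odd_primes_upto x)"
  by (rule finite_subset [of _ "{..nat \<lfloor>x\<rfloor>}"]) (auto simp: odd_primes_upto_def le_nat_floor)

text \<open>The numerator of the difference over the common denominator \<open>q * q'\<close> is a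
  nonzero integer, and \<open>q * q'\<close> is at most \<open>Q\<^sup>2\<close>.\<close>

lemma prime_fractions_separated:
  assumes "prime q" "prime q'" "real q \<le> Q" "real q' \<le> Q"
    and "d \<in> {1..q - 1}" "d' \<in> {1..q' - 1}" "(q, d) \<noteq> (q', d')"
  shows "\<bar>real d / real q - real d' / real q'\<bar> \<ge> 1 / Q\<^sup>2"
proof -
  have pos: "q > 0" "q' > 0" using assms(1,2) by (auto simp: prime_gt_0_nat)
  \<comment> \<open>The fractions are in lowest terms: \<open>q\<close> does not divide
    \<open>d\<close>, so equality would force \<open>q\<close> to divide \<open>q'\<close>, hence
    \<open>q = q'\<close> and \<open>d = d'\<close>.\<close>
  have "int d * int q' \<noteq> int d' * int q"
  proof
    assume "int d * int q' = int d' * int q"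
    then have eq: "d * q' = d' * q" by (metis of_nat_eq_iff of_nat_mult)
    have "\<not> q dvd d" using assms(5) by (auto dest: dvd_imp_le)
    moreover have "q dvd d * q'" by (simp add: eq)
    ultimately have "q dvd q'" using assms(1) by (simp add: prime_dvd_mult_iff)
    then have "q = q'" using assms(1,2) primes_dvd_imp_eq by blast
    then show False using eq assms(7) pos by simp
  qed
  then have "\<bar>int d * int q' - int d' * int q\<bar> \<ge> 1" by linarith
  then have "real_of_int \<bar>int d * int q' - int d' * int q\<bar> \<ge> 1" by linarith
  then have 1: "\<bar>real d * real q' - real d' * real q\<bar> \<ge> 1" by simp
  have "real q * real q' \<le> Q\<^sup>2"
    unfolding power2_eq_square using assms(3,4) by (intro mult_mono) auto
  then have "1 / Q\<^sup>2 \<le> 1 / (real q * real q')"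
    using pos assms(3) by (intro divide_left_mono mult_pos_pos) auto
  also have "\<dots> \<le> \<bar>real d * real q' - real d' * real q\<bar> / (real q * real q')"
    using 1 pos by (intro divide_right_mono) auto
  also have "\<dots> = \<bar>(real d * real q' - real d' * real q) / (real q * real q')\<bar>"
    by (simp add: abs_mult)
  also have "(real d * real q' - real d' * real q) / (real q * real q') = real d / real q - real d' / real q'"
    using pos by (simp add: field_simps)
  finally show ?thesis .
qed

lemma large_sieve_primes:
  assumes "Q \<ge> 1" "x \<ge> 0" and N: "\<And>n. n \<in> N \<Longrightarrow> real n \<le> x"
  shows "(\<Sum>q\<in>odd_primes_upto Q. \<Sum>d\<in>{1..q - 1}. (cmod (\<Sum>n\<in>N. a n * e (real n * (real d / real q))))\<^sup>2)
    \<le> 12 * (Q\<^sup>2 + x) * (\<Sum>n\<in>N. (cmod (a n))\<^sup>2)"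
proof -
  define R where "R = (SIGMA q:odd_primes_upto Q. {1..q - 1})"
  define \<alpha> :: "nat \<times> nat \<Rightarrow> real" where "\<alpha> r = real (snd r) / real (fst r)" for r
  define G where "G r = (cmod (\<Sum>n\<in>N. a n * e (real n * \<alpha> r)))\<^sup>2" for r
  \<comment> \<open>One choice meets both demands on \<open>L\<close>: it is at least
    \<open>Q\<^sup>2\<close>, the inverse of the spacing, and it bounds the elements of
    \<open>N\<close>. Rounding up costs at most a factor 2, as \<open>Q\<^sup>2 + x\<close> is at
    least 1.\<close>
  define L where "L = nat \<lceil>Q\<^sup>2 + x\<rceil>"
  define Y where "Y = (\<Sum>n\<in>N. (cmod (a n))\<^sup>2)"
  have "Q\<^sup>2 \<ge> 1" using assms(1) by simp
  have "finite R" by (simp add: R_def finite_odd_primes_upto)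
  have L: "Q\<^sup>2 + x \<le> real L" "real L \<le> 2 * (Q\<^sup>2 + x)"
    using \<open>Q\<^sup>2 \<ge> 1\<close> assms(2) ceiling_correct [of "Q\<^sup>2 + x"] by (simp_all add: L_def)
  have "Y \<ge> 0" by (simp add: Y_def sum_nonneg)
  have \<alpha>: "0 < \<alpha> r" "\<alpha> r < 1" if "r \<in> R" for r
    using that by (auto simp: R_def \<alpha>_def)
  have half: "(\<Sum>r\<in>A. G r) \<le> 3 * real L * Y"
    if "A \<subseteq> R" and near: "\<And>r s. r \<in> A \<Longrightarrow> s \<in> A \<Longrightarrow> \<bar>\<alpha> r - \<alpha> s\<bar> \<le> 1 / 2" for A
    unfolding G_def Y_def
  proof (rule large_sieve_half_interval [where \<delta> = "1 / Q\<^sup>2"])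
    show "finite A" using \<open>finite R\<close> \<open>A \<subseteq> R\<close> by (rule rev_finite_subset)
    show "1 / Q\<^sup>2 > 0" using assms(1) by simp
    show "1 / Q\<^sup>2 \<le> \<bar>\<alpha> r - \<alpha> s\<bar>" if "r \<in> A" "s \<in> A" "r \<noteq> s" for r s
    proof -
      have "r \<in> R" "s \<in> R" using that \<open>A \<subseteq> R\<close> by auto
      then show ?thesis
        unfolding \<alpha>_def using that(3)
        by (intro prime_fractions_separated) (auto simp: R_def odd_primes_upto_def prod_eq_iff)
    qed
    show "\<bar>\<alpha> r - \<alpha> s\<bar> \<le> 1 / 2" if "r \<in> A" "s \<in> A" for r s by (rule near [OF that])
    show "1 / (1 / Q\<^sup>2) \<le> real L" using L assms(2) by simp
    show "N \<subseteq> {..L}"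
    proof
      fix n assume "n \<in> N"
      then have "real n \<le> real L" using N [of n] L(1) \<open>Q\<^sup>2 \<ge> 1\<close> by linarith
      then show "n \<in> {..L}" by simp
    qed
  qed
  have "(\<Sum>q\<in>odd_primes_upto Q. \<Sum>d\<in>{1..q - 1}. (cmod (\<Sum>n\<in>N. a n * e (real n * (real d / real q))))\<^sup>2)
      = (\<Sum>r\<in>R. G r)"
    unfolding R_def G_def \<alpha>_def
    by (subst sum.Sigma) (auto simp: finite_odd_primes_upto case_prod_unfold)
  \<comment> \<open>All fractions lie strictly between 0 and 1, so within either half they differ by
    at most 1/2. Two halves, the sieve constant 3 and the rounding factor 2 multiply to 12.\<close>
  also have "\<dots> = (\<Sum>r\<in>{r \<in> R. \<alpha> r \<le> 1 / 2}. G r) + (\<Sum>r\<in>{r \<in> R. \<not> \<alpha> r \<le> 1 / 2}. G r)"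
    using \<open>finite R\<close> by (subst sum.union_disjoint [symmetric]) (auto intro!: sum.cong)
  also have "\<dots> \<le> 3 * real L * Y + 3 * real L * Y"
  proof (intro add_mono half)
    show "\<bar>\<alpha> r - \<alpha> s\<bar> \<le> 1 / 2" if "r \<in> {r \<in> R. \<alpha> r \<le> 1 / 2}" "s \<in> {r \<in> R. \<alpha> r \<le> 1 / 2}" for r s
      using that \<alpha> [of r] \<alpha> [of s] unfolding mem_Collect_eq by linarith
    show "\<bar>\<alpha> r - \<alpha> s\<bar> \<le> 1 / 2" if "r \<in> {r \<in> R. \<not> \<alpha> r \<le> 1 / 2}" "s \<in> {r \<in> R. \<not> \<alpha> r \<le> 1 / 2}" for r s
      using that \<alpha> [of r] \<alpha> [of s] unfolding mem_Collect_eq by linarith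
  qed auto
  also have "\<dots> = 6 * (real L * Y)" by simp
  also have "\<dots> \<le> 6 * (2 * (Q\<^sup>2 + x) * Y)"
    using L(2) \<open>Y \<ge> 0\<close> by (intro mult_left_mono mult_right_mono) auto
  also have "\<dots> = 12 * (Q\<^sup>2 + x) * Y" by simp
  finally show ?thesis unfolding Y_def .
qed

section \<open>Orthogonality modulo q\<close>

text \<open>The sum is geometric with ratio a \<open>q\<close>-th root of unity, so it vanishes
  unless that root is 1.\<close>

lemma sum_e_residues:
  assumes "q > 0"
  shows "(\<Sum>c<q. e (real c * (of_int h / real q))) = (if int q dvd h then of_nat q else 0)"
proof -
  let ?z = "e (of_int h / real q)"
  have z: "?z = 1 \<longleftrightarrow> int q dvd h"
  proof -
    have "of_int h / real q \<in> \<int> \<longleftrightarrow> int q dvd h"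
      using assms of_int_div_of_int_in_Ints_iff [of h "int q", where 'a = real] by simp
    then show ?thesis by (simp add: e_eq_1_iff)
  qed
  have "?z ^ q = 1" using assms by (simp add: e_power e_eq_1_iff)
  then have "(?z - 1) * (\<Sum>c<q. ?z ^ c) = 0"
    using power_diff_1_eq [of ?z q] by simp
  then have "?z = 1 \<or> (\<Sum>c<q. ?z ^ c) = 0" by simp
  then show ?thesis using z by (auto simp only: e_power [symmetric] power_one sum_constant card_lessThan mult_1_right if_True if_False)
qed

text \<open>Within a residue class a number is determined by its quotient by \<open>q\<close>, which
  ranges over 0, ..., \<open>M div q\<close>.\<close>

lemma card_residue_class_le:
  assumes "q > 0"
  shows "card {m'. m' \<le> M \<and> m' mod q = m mod q} \<le> M div q + 1"
proof -
  have "inj_on (\<lambda>m'. m' div q) {m'. m' \<le> M \<and> m' mod q = m mod q}"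
    by (rule inj_onI) (metis (mono_tags, lifting) div_mult_mod_eq mem_Collect_eq)
  then have "card {m'. m' \<le> M \<and> m' mod q = m mod q} \<le> card {..M div q}"
    by (rule card_inj_on_le) (auto intro: div_le_mono)
  then show ?thesis by simp
qed

text \<open>Schur's test with c as summation variable and m as index: by orthogonality the Gram
  entry is \<open>q\<close> for congruent indices and 0 otherwise, so a row sums to at most
  \<open>q * (M div q + 1)\<close>.\<close>

lemma sum_residues_norm_square_le:
  assumes "q > 0"
  shows "(\<Sum>c<q. (cmod (\<Sum>m\<le>M. b m * e (- (real m * real c / real q))))\<^sup>2)
    \<le> (real q + real M) * (\<Sum>m\<le>M. (cmod (b m))\<^sup>2)"
proof (rule sum_norm_square_le_row_sum [where \<kappa> = "\<lambda>m m'. if m' mod q = m mod q then real q else 0"])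
  fix m m' :: nat
  have "(\<Sum>c<q. e (- (real m * real c / real q)) * cnj (e (- (real m' * real c / real q))))
      = (\<Sum>c<q. e (real c * (of_int (int m' - int m) / real q)))"
    by (intro sum.cong refl) (simp add: cnj_e algebra_simps diff_divide_distrib flip: e_add)
  also have "\<dots> = (if m' mod q = m mod q then of_nat q else 0)"
    unfolding sum_e_residues [OF assms] by (metis mod_eq_dvd_iff of_nat_eq_iff zmod_int)
  finally show "cmod (\<Sum>c<q. e (- (real m * real c / real q)) * cnj (e (- (real m' * real c / real q))))
      \<le> (if m' mod q = m mod q then real q else 0)"
    by simp
next
  fix m :: nat
  have "(\<Sum>m'\<le>M. if m' mod q = m mod q then real q else 0)
      = real q * real (card {m'. m' \<le> M \<and> m' mod q = m mod q})"
    by (subst sum.If_cases) (auto simp: Int_def)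
  also have "\<dots> \<le> real q * real (M div q + 1)"
    by (intro mult_left_mono of_nat_mono card_residue_class_le assms) simp
  also have "\<dots> \<le> real q + real M"
    by (simp add: ring_distribs) (metis div_times_less_eq_dividend mult.commute of_nat_le_iff of_nat_mult)
  finally show "(\<Sum>m'\<le>M. if m' mod q = m mod q then real q else 0) \<le> real q + real M" .
qed auto

text \<open>Serves the sum over c for fixed \<open>q\<close> and \<open>d\<close>, with
  \<open>i\<close> the index of 2 and \<open>a p\<close> the phase in \<open>d\<close>. Adding the
  nonnegative term c = 0 completes the residue system.\<close>

lemma sum_group_residues_norm_square_le:
  fixes i :: "'p \<Rightarrow> nat"
  assumes "q > 0" "finite P" "\<And>p. p \<in> P \<Longrightarrow> i p \<le> M"
  shows "(\<Sum>c\<in>{1..q - 1}. (cmod (\<Sum>p\<in>P. a p * e (- (real (i p) * real c / real q))))\<^sup>2)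
    \<le> (real q + real M) * (\<Sum>m\<le>M. (cmod (\<Sum>p\<in>{p \<in> P. i p = m}. a p))\<^sup>2)"
proof -
  have group: "(\<Sum>p\<in>P. a p * e (- (real (i p) * real c / real q)))
      = (\<Sum>m\<le>M. (\<Sum>p\<in>{p \<in> P. i p = m}. a p) * e (- (real m * real c / real q)))" for c
  proof -
    have "(\<Sum>p\<in>P. a p * e (- (real (i p) * real c / real q)))
      = (\<Sum>m\<le>M. \<Sum>p\<in>{p \<in> P. i p = m}. a p * e (- (real (i p) * real c / real q)))"
      using assms by (intro sum.group [symmetric]) auto
    then show ?thesis by (simp add: sum_distrib_right)
  qed
  have "(\<Sum>c\<in>{1..q - 1}. (cmod (\<Sum>p\<in>P. a p * e (- (real (i p) * real c / real q))))\<^sup>2)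
      \<le> (\<Sum>c<q. (cmod (\<Sum>p\<in>P. a p * e (- (real (i p) * real c / real q))))\<^sup>2)"
    using assms(1) by (intro sum_mono2) auto
  also have "\<dots> \<le> (real q + real M) * (\<Sum>m\<le>M. (cmod (\<Sum>p\<in>{p \<in> P. i p = m}. a p))\<^sup>2)"
    unfolding group by (rule sum_residues_norm_square_le [OF assms(1)])
  finally show ?thesis .
qed

section \<open>Combining orthogonality in c with the large sieve in d / q\<close>

theorem theorem3:
  shows "\<exists>K::real. K > 0 \<and> (\<forall>Q x :: real. Q \<ge> 2 \<longrightarrow> x \<ge> 2 \<longrightarrow>
    (\<Sum>q\<in>odd_primes_upto Q. \<Sum>c\<in>{1..q - 1}. \<Sum>d\<in>{1..q - 1}.
       (cmod (\<Sum>p\<in>admissible_primes x.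
          e ((real p * real d - real (index2 p) * real c) / real q)))\<^sup>2)
    \<le> K * (Q + sqrt x * ln x) * (Q\<^sup>2 + x) * real (primes_pi x))"
\<comment> \<open>The constant is that of \<open>large_sieve_primes\<close>; the remaining estimates
  have constant 1.\<close>
proof (intro exI [of _ 12] conjI allI impI)
  fix Q x :: real
  assume Q: "Q \<ge> 2" and x: "x \<ge> 2"
  define P where "P = admissible_primes x"
  define M where "M = nat \<lfloor>sqrt x * ln x\<rfloor>"
  define Pm where "Pm m = {p \<in> P. index2 p = m}" for m
  define B where "B q d m = (cmod (\<Sum>p\<in>Pm m. e (real p * (real d / real q))))\<^sup>2" for q d m :: nat
  have P_sub: "P \<subseteq> odd_primes_upto x" by (auto simp: P_def admissible_primes_def)
  then have "finite P" using finite_odd_primes_upto by (rule finite_subset)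
  have "sqrt x * ln x \<ge> 0" using x by simp
  then have M: "real M \<le> sqrt x * ln x" by (simp add: M_def)
  have index_le: "index2 p \<le> M" if "p \<in> P" for p
    using that by (simp add: P_def admissible_primes_def M_def le_nat_floor)
  have fixed: "(\<Sum>c\<in>{1..q - 1}. \<Sum>d\<in>{1..q - 1}. (cmod (\<Sum>p\<in>P.
        e ((real p * real d - real (index2 p) * real c) / real q)))\<^sup>2)
      \<le> (Q + sqrt x * ln x) * (\<Sum>d\<in>{1..q - 1}. \<Sum>m\<le>M. B q d m)" if "q \<in> odd_primes_upto Q" for q
  proof -
    have q: "q > 0" "real q \<le> Q" using that by (auto simp: odd_primes_upto_def prime_gt_0_nat)
    \<comment> \<open>With \<open>d\<close> outermost, the phase factors into a coefficient
      depending on \<open>p\<close> and \<open>d\<close> and a character in c that sees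
      \<open>p\<close> only through \<open>index2 p\<close>.\<close>
    have "(\<Sum>c\<in>{1..q - 1}. \<Sum>d\<in>{1..q - 1}. (cmod (\<Sum>p\<in>P.
          e ((real p * real d - real (index2 p) * real c) / real q)))\<^sup>2)
      = (\<Sum>d\<in>{1..q - 1}. \<Sum>c\<in>{1..q - 1}. (cmod (\<Sum>p\<in>P.
          e (real p * (real d / real q)) * e (- (real (index2 p) * real c / real q))))\<^sup>2)"
      by (subst sum.swap) (simp add: diff_divide_distrib flip: e_add)
    also have "\<dots> \<le> (\<Sum>d\<in>{1..q - 1}. (real q + real M) * (\<Sum>m\<le>M. B q d m))"
      unfolding B_def Pm_def
      by (intro sum_mono sum_group_residues_norm_square_le q \<open>finite P\<close> index_le)
    also have "\<dots> \<le> (\<Sum>d\<in>{1..q - 1}. (Q + sqrt x * ln x) * (\<Sum>m\<le>M. B q d m))"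
      using q M by (intro sum_mono mult_right_mono sum_nonneg) (auto simp: B_def)
    finally show ?thesis by (simp add: sum_distrib_left)
  qed
  have "(\<Sum>q\<in>odd_primes_upto Q. \<Sum>d\<in>{1..q - 1}. \<Sum>m\<le>M. B q d m)
      = (\<Sum>m\<le>M. \<Sum>q\<in>odd_primes_upto Q. \<Sum>d\<in>{1..q - 1}. B q d m)"
    by (subst (2) sum.swap, subst sum.swap) (rule refl)
  also have "\<dots> \<le> (\<Sum>m\<le>M. 12 * (Q\<^sup>2 + x) * real (card (Pm m)))"
  proof (rule sum_mono)
    fix m
    have "real n \<le> x" if "n \<in> Pm m" for n
      using that P_sub by (auto simp: Pm_def odd_primes_upto_def)
    \<comment> \<open>All coefficients are 1 here, so the sum of their squares is the size of the
      fibre \<open>Pm m\<close>.\<close>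
    then show "(\<Sum>q\<in>odd_primes_upto Q. \<Sum>d\<in>{1..q - 1}. B q d m) \<le> 12 * (Q\<^sup>2 + x) * real (card (Pm m))"
      using large_sieve_primes [of Q x "Pm m" "\<lambda>_. 1"] Q x by (simp add: B_def)
  qed
  also have "\<dots> = 12 * (Q\<^sup>2 + x) * (\<Sum>m\<le>M. \<Sum>p\<in>Pm m. 1)"
    by (simp add: sum_distrib_left)
  \<comment> \<open>Admissibility puts every index at most \<open>M\<close>, so the fibres partition
    \<open>P\<close> and their sizes add up to at most \<pi>(x).\<close>
  also have "(\<Sum>m\<le>M. \<Sum>p\<in>Pm m. 1) = (\<Sum>p\<in>P. 1 :: real)"
    unfolding Pm_def using \<open>finite P\<close> index_le by (intro sum.group) auto
  also have "\<dots> \<le> real (primes_pi x)"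
  proof -
    have "finite {p :: nat. prime p \<and> real p \<le> x}"
      by (rule finite_subset [of _ "{..nat \<lfloor>x\<rfloor>}"]) (auto simp: le_nat_floor)
    then have "card P \<le> primes_pi x"
      unfolding primes_pi_def using P_sub by (intro card_mono) (auto simp: odd_primes_upto_def)
    then show ?thesis by simp
  qed
  finally have sieve: "(\<Sum>q\<in>odd_primes_upto Q. \<Sum>d\<in>{1..q - 1}. \<Sum>m\<le>M. B q d m)
      \<le> 12 * (Q\<^sup>2 + x) * real (primes_pi x)"
    using x by (simp add: mult_left_mono)
  have "(\<Sum>q\<in>odd_primes_upto Q. \<Sum>c\<in>{1..q - 1}. \<Sum>d\<in>{1..q - 1}. (cmod (\<Sum>p\<in>P.
        e ((real p * real d - real (index2 p) * real c) / real q)))\<^sup>2)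
      \<le> (\<Sum>q\<in>odd_primes_upto Q. (Q + sqrt x * ln x) * (\<Sum>d\<in>{1..q - 1}. \<Sum>m\<le>M. B q d m))"
    by (rule sum_mono [OF fixed])
  also have "\<dots> = (Q + sqrt x * ln x) * (\<Sum>q\<in>odd_primes_upto Q. \<Sum>d\<in>{1..q - 1}. \<Sum>m\<le>M. B q d m)"
    by (simp add: sum_distrib_left)
  also have "\<dots> \<le> (Q + sqrt x * ln x) * (12 * (Q\<^sup>2 + x) * real (primes_pi x))"
    using sieve Q \<open>sqrt x * ln x \<ge> 0\<close> by (intro mult_left_mono) auto
  finally show "(\<Sum>q\<in>odd_primes_upto Q. \<Sum>c\<in>{1..q - 1}. \<Sum>d\<in>{1..q - 1}.
       (cmod (\<Sum>p\<in>admissible_primes x.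
          e ((real p * real d - real (index2 p) * real c) / real q)))\<^sup>2)
    \<le> 12 * (Q + sqrt x * ln x) * (Q\<^sup>2 + x) * real (primes_pi x)"
    by (simp only: P_def mult_ac)
qed simp

end
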